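(* Let $(X,\Sigma,\mu)$ be a non-atomic probability space equipped with a measure-preserving $\mathbb{Z}$-action $\tau$. For any $C>0$, there exists an $f=f_C$ of $L^2$-norm one, but so that $$\big\|\mathcal{V}^2(M_N f)\big\|_{L^2(X)}\ge C,$$ where $$M_N f(x):=\frac1N\sum_{n\le N}\tau^{n^2}f(x)$$ are the (discrete) square means. (That is, the $2$-variation operator is unbounded on $L^2$.)
   Context: The $\mathbb{Z}$-action acts on functions by $\tau^{y}f(x)=\tau_y f(x)=f(\tau_{-y}x)$ for $y\in\mathbb{Z}$. The index $N$ ranges over the positive integers and the sum defining $M_N f$ is over integers $1\le n\le N$. For a collection of functions $\{f_i\}$, the $2$-variation is $$\mathcal{V}^2(f_i)(x):=\sup_{(i_k)\text{ increasing}}\Big(\sum_k|f_{i_k}(x)-f_{i_{k+1}}(x)|^2\Big)^{1/2},$$ the supremum being over increasing sequences of indices; $\mathcal{V}^2(M_N f)$ is the $2$-variation of the family $\{M_N f\}_{N\ge1}$.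
   Formalization: The formal theorem also assumes that no τ_q with q ≠ 0 fixes every measurable set up to null sets; without this the claim is false (for the trivial action M_N f = f, so the 2-variation is 0), and it fails for large C whenever the condition fails. *)

theory Defs
  imports "HOL-Probability.Probability"
begin

definition nonatomic :: "'a measure \<Rightarrow> bool" where
  "nonatomic M \<longleftrightarrow>
     (\<forall>A\<in>sets M. 0 < emeasure M A \<longrightarrow>
        (\<exists>B\<in>sets M. B \<subseteq> A \<and> 0 < emeasure M B \<and> emeasure M B < emeasure M A))"

definition measure_preserving_int_action :: "'a measure \<Rightarrow> (int \<Rightarrow> 'a \<Rightarrow> 'a) \<Rightarrow> bool" where
  "measure_preserving_int_action M \<tau> \<longleftrightarrow>
     (\<forall>y. \<tau> y \<in> M \<rightarrow>\<^sub>M M) \<and>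
     (\<forall>y. \<forall>A\<in>sets M. emeasure M (\<tau> y -` A \<inter> space M) = emeasure M A) \<and>
     (\<forall>x\<in>space M. \<tau> 0 x = x) \<and>
     (\<forall>y z. \<forall>x\<in>space M. \<tau> (y + z) x = \<tau> y (\<tau> z x))"

text \<open>
  The action does not factor, modulo null sets, through a finite quotient of the integers: no
  \<open>\<tau> q\<close> with \<open>q \<noteq> 0\<close> fixes every measurable set up to a null set. This holds for every
  ergodic action on a non-atomic space and for every essentially free action on a standard
  probability space. Some such condition cannot be avoided in statements about unboundedness of
  the \<open>2\<close>-variation: if \<open>\<tau> q\<close> is the identity, then \<open>square_mean \<tau> N f\<close> converges at rate \<open>1/N\<close>
  and the \<open>2\<close>-variation is bounded; for the trivial action it is \<open>0\<close>.
\<close>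
definition essentially_faithful :: "'a measure \<Rightarrow> (int \<Rightarrow> 'a \<Rightarrow> 'a) \<Rightarrow> bool" where
  "essentially_faithful M \<tau> \<longleftrightarrow>
     (\<forall>q. q \<noteq> 0 \<longrightarrow>
        (\<exists>A\<in>sets M. 0 < emeasure M (sym_diff A (\<tau> q -` A \<inter> space M))))"

definition translate :: "(int \<Rightarrow> 'a \<Rightarrow> 'a) \<Rightarrow> int \<Rightarrow> ('a \<Rightarrow> 'b) \<Rightarrow> 'a \<Rightarrow> 'b" where
  "translate \<tau> y f x = f (\<tau> (- y) x)"

definition square_mean :: "(int \<Rightarrow> 'a \<Rightarrow> 'a) \<Rightarrow> nat \<Rightarrow> ('a \<Rightarrow> complex) \<Rightarrow> 'a \<Rightarrow> complex" where
  "square_mean \<tau> N f x = (1 / of_nat N) * (\<Sum>n=1..N. translate \<tau> ((int n)\<^sup>2) f x)"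

definition esqrt :: "ennreal \<Rightarrow> ennreal" where
  "esqrt a = (if a = \<infinity> then \<infinity> else ennreal (sqrt (enn2real a)))"

text \<open>
  The family is indexed by the positive integers, so the value at index \<open>0\<close> is ignored. Finite
  increasing sequences of indices need not be included separately: each extends to an infinite
  one, which only adds nonnegative terms to the sum.
\<close>
definition variation2 :: "(nat \<Rightarrow> 'a \<Rightarrow> complex) \<Rightarrow> 'a \<Rightarrow> ennreal" where
  "variation2 F x =
     (SUP i\<in>{i :: nat \<Rightarrow> nat. strict_mono i \<and> (\<forall>k. 1 \<le> i k)}.
        esqrt (\<Sum>k. ennreal ((cmod (F (i k) x - F (i (Suc k)) x))\<^sup>2)))"

text \<open>The \<open>L\<^sup>2\<close> norm of a function with values in \<open>[0, \<infinity>]\<close>; it is infinite outside \<open>L\<^sup>2\<close>.\<close>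
definition eL2_norm :: "'a measure \<Rightarrow> ('a \<Rightarrow> ennreal) \<Rightarrow> ennreal" where
  "eL2_norm M g = esqrt (\<integral>\<^sup>+x. (g x)\<^sup>2 \<partial>M)"

end

theory Submission
  imports Defs
begin

text \<open>
  The counterexample is a random walk in disguise. Let \<open>s\<^sub>1, s\<^sub>2, \<dots>\<close> be odd integers, each dividing the
  next and each much larger than the square of the one before, and let \<open>r\<^sub>k\<close> be the square wave
  on the integers that changes its sign after every \<open>s\<^sub>k\<close> steps. Average \<open>r\<^sub>k\<close> over the first
  \<open>N = 2 * s\<^sub>j\<close> squares. If \<open>k > j\<close>, then \<open>N\<^sup>2\<close> is tiny compared with \<open>s\<^sub>k\<close>, and at every point
  outside a sparse set nothing changes. If \<open>k \<le> j\<close>, the average is exactly \<open>0\<close>: shifting the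
  summation index \<open>i\<close> by \<open>s\<^sub>k\<close> changes \<open>i\<^sup>2\<close> by an odd multiple of \<open>s\<^sub>k\<close>, which flips the wave, so
  the terms cancel in pairs. Hence the square means of \<open>r\<^sub>1 + \<dots> + r\<^sub>n\<close> at the times \<open>2 * s\<^sub>j\<close> are the
  tails \<open>r\<^bsub>j+1\<^esub> + \<dots> + r\<^sub>n\<close> (lemma \<open>square_mean_signal\<close>), while the signs
  \<open>(r\<^sub>1, \<dots>, r\<^sub>n)\<close> run through all patterns equally often outside the sparse set (lemma
  \<open>sum_deep\<close>).

  The unboundedness therefore comes from the fact that the quadratic variation of a simple
  random walk of length \<open>n\<close>, with the times chosen in dependence on the path, is not \<open>O(n)\<close> in
  the mean (lemma \<open>square_variation_unbounded\<close>). Cut a long walk into \<open>l\<close> walks of length \<open>n\<close>. The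
  variation is at least the sum of the variations of the pieces, which gives no loss. With
  probability at least \<open>48\<^sup>-\<^sup>l\<close> every piece makes a displacement of order \<open>sqrt n\<close> in the same
  direction although its variation is only \<open>O(n)\<close>; then the single jump across the whole walk
  contributes of order \<open>l\<^sup>2 * n\<close>, much more than the pieces together. So the mean variation per step
  grows by a fixed amount whenever the length is multiplied by \<open>l\<close>, for as long as it stays
  bounded, and thus it cannot stay bounded.

  Finally the example is carried over from the integers to the space. The action being
  faithful modulo null sets, there is a set \<open>E\<close> of positive measure whose first \<open>H\<close> translates are
  disjoint (lemma \<open>exists_set_without_short_returns\<close>). Copying a function on \<open>{0..<H}\<close> to this tower
  multiplies sums by the measure of \<open>E\<close>, which the normalisation of the \<open>L\<^sup>2\<close> norm removes again.
\<close>

section \<open>Sums over words\<close>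

definition words :: "'b set \<Rightarrow> nat \<Rightarrow> 'b list set" where
  "words U l = {w. set w \<subseteq> U \<and> length w = l}"

lemma finite_words: "finite U \<Longrightarrow> finite (words U l)"
  unfolding words_def by (rule finite_lists_length_eq)

lemma card_words: "finite U \<Longrightarrow> card (words U l) = card U ^ l"
  unfolding words_def by (rule card_lists_length_eq)

lemma words_0 [simp]: "words U 0 = {[]}"
  by (auto simp: words_def)

lemma sum_words_Suc:
  fixes g :: "'b list \<Rightarrow> 'c::comm_monoid_add"
  shows "(\<Sum>w\<in>words U (Suc l). g w) = (\<Sum>u\<in>U. \<Sum>w\<in>words U l. g (u # w))"
proof -
  have "bij_betw (\<lambda>(u, w). u # w) (U \<times> words U l) (words U (Suc l))"
    by (rule bij_betw_byWitness[where f' = "\<lambda>w. (hd w, tl w)"])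
       (auto simp: words_def length_Suc_conv)
  then have "(\<Sum>w\<in>words U (Suc l). g w) = (\<Sum>(u, w)\<in>U \<times> words U l. g (u # w))"
    by (subst sum.reindex_bij_betw[symmetric]) (auto simp: case_prod_unfold)
  then show ?thesis
    by (simp add: sum.cartesian_product)
qed

lemma sum_words_add:
  fixes g :: "'b list \<Rightarrow> 'c::comm_monoid_add"
  shows "(\<Sum>w\<in>words U (k + l). g w) = (\<Sum>u\<in>words U k. \<Sum>v\<in>words U l. g (u @ v))"
  by (induction k arbitrary: g) (simp_all add: sum_words_Suc)

lemma sum_words_concat:
  fixes g :: "'b list \<Rightarrow> 'c::comm_monoid_add"
  shows "(\<Sum>w\<in>words U (l * n). g w) = (\<Sum>W\<in>words (words U n) l. g (concat W))"
  by (induction l arbitrary: g) (simp_all add: sum_words_Suc sum_words_add)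

lemma sum_words_snoc:
  fixes g :: "'b list \<Rightarrow> 'c::comm_monoid_add"
  shows "(\<Sum>w\<in>words U (Suc l). g w) = (\<Sum>w\<in>words U l. \<Sum>u\<in>U. g (w @ [u]))"
  using sum_words_add[of g U l 1] by (simp add: sum_words_Suc)

lemma sum_words_additive:
  fixes h :: "'b \<Rightarrow> real"
  assumes "finite U"
  shows "(\<Sum>w\<in>words U l. \<Sum>u\<leftarrow>w. h u) * card U = l * card U ^ l * (\<Sum>u\<in>U. h u)"
proof (induction l)
  case (Suc l)
  have "(\<Sum>w\<in>words U (Suc l). \<Sum>u\<leftarrow>w. h u)
      = card U ^ l * (\<Sum>u\<in>U. h u) + card U * (\<Sum>w\<in>words U l. \<Sum>u\<leftarrow>w. h u)"
    by (simp add: sum_words_Suc sum.distrib card_words[OF assms] sum_distrib_left)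
  then have "(\<Sum>w\<in>words U (Suc l). \<Sum>u\<leftarrow>w. h u) * card U
      = card U ^ Suc l * (\<Sum>u\<in>U. h u) + card U * ((\<Sum>w\<in>words U l. \<Sum>u\<leftarrow>w. h u) * card U)"
    by (simp add: algebra_simps)
  then show ?case
    by (simp only: Suc.IH) (simp add: algebra_simps)
qed simp

section \<open>Quadratic variation of random walks\<close>

abbreviation cube :: "nat \<Rightarrow> real list set" where
  "cube n \<equiv> words {-1, 1} n"

lemma card_cube: "card (cube n) = 2 ^ n"
  by (simp add: card_words numeral_2_eq_2)

lemma sum_cube_square: "(\<Sum>xs\<in>cube n. (sum_list xs)\<^sup>2) = n * 2 ^ n"
proof (induction n)
  case (Suc n)
  have "(\<Sum>xs\<in>cube (Suc n). (sum_list xs)\<^sup>2) = (\<Sum>xs\<in>cube n. 2 * (sum_list xs)\<^sup>2 + 2)"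
    unfolding sum_words_Suc
    by (simp add: power2_eq_square algebra_simps flip: sum.distrib)
  then show ?case
    using Suc by (simp add: sum.distrib card_cube algebra_simps flip: sum_distrib_left)
qed simp

lemma sum_cube_fourth:
  "(\<Sum>xs\<in>cube n. (sum_list xs) ^ 4) = (3 * (real n)\<^sup>2 - 2 * real n) * 2 ^ n"
proof (induction n)
  case (Suc n)
  have "(\<Sum>xs\<in>cube (Suc n). (sum_list xs) ^ 4)
      = (\<Sum>xs\<in>cube n. 2 * (sum_list xs) ^ 4 + 12 * (sum_list xs)\<^sup>2 + 2)"
    unfolding sum_words_Suc
    by (simp flip: sum.distrib)
      (intro sum.cong refl, simp add: power2_eq_square power4_eq_xxxx algebra_simps)
  then show ?case
    using Suc by (simp add: sum.distrib card_cube sum_cube_square flip: sum_distrib_left)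
      (simp add: algebra_simps power2_eq_square)
qed simp

definition partitions :: "'b list \<Rightarrow> 'b list list set" where
  "partitions xs = {yss. concat yss = xs \<and> [] \<notin> set yss}"

definition block_squares :: "real list list \<Rightarrow> real" where
  "block_squares yss = (\<Sum>ys\<leftarrow>yss. (sum_list ys)\<^sup>2)"

text \<open>
  The square of the \<open>2\<close>-variation of the path with increments \<open>xs\<close>: cutting \<open>xs\<close> into nonempty
  blocks amounts to choosing times, and the sum of a block is the displacement between two
  consecutive times.
\<close>
definition square_variation :: "real list \<Rightarrow> real" where
  "square_variation xs = Max (block_squares ` partitions xs)"

lemma length_le_concat: "[] \<notin> set yss \<Longrightarrow> length yss \<le> length (concat yss)"
proof (induction yss)
  case (Cons ys yss)
  then show ?case by (cases ys) auto
qed simp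

lemma finite_partitions: "finite (partitions xs)"
proof (rule finite_subset)
  let ?Y = "{ys. set ys \<subseteq> set xs \<and> length ys \<le> length xs}"
  show "partitions xs \<subseteq> {yss. set yss \<subseteq> ?Y \<and> length yss \<le> length xs}"
  proof safe
    fix yss ys y
    assume "yss \<in> partitions xs"
    then have c: "concat yss = xs" and n: "[] \<notin> set yss"
      by (auto simp: partitions_def)
    show "length yss \<le> length xs"
      using length_le_concat[OF n] c by simp
    assume ys: "ys \<in> set yss"
    then show "y \<in> set ys \<Longrightarrow> y \<in> set xs"
      using c by auto
    obtain us vs where "yss = us @ ys # vs"
      using split_list[OF ys] by blast
    then show "length ys \<le> length xs"
      using c by auto
  qed
  show "finite {yss. set yss \<subseteq> ?Y \<and> length yss \<le> length xs}"
    by (intro finite_lists_length_le) simp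
qed

lemma partitions_nonempty: "partitions xs \<noteq> {}"
proof -
  have "concat (if xs = [] then [] else [xs]) = xs" by simp
  then have "(if xs = [] then [] else [xs]) \<in> partitions xs"
    by (auto simp: partitions_def)
  then show ?thesis by blast
qed

lemma square_variation_upper: "yss \<in> partitions xs \<Longrightarrow> block_squares yss \<le> square_variation xs"
  unfolding square_variation_def by (intro Max_ge) (auto simp: finite_partitions)

lemma square_variation_attained:
  obtains yss where "yss \<in> partitions xs" "square_variation xs = block_squares yss"
proof -
  have "square_variation xs \<in> block_squares ` partitions xs"
    unfolding square_variation_def using finite_partitions partitions_nonempty by (intro Max_in) auto
  then show ?thesis using that by blast
qed

lemma square_variation_nonneg: "0 \<le> square_variation xs"
proof -
  obtain yss where "square_variation xs = block_squares yss"
    by (rule square_variation_attained)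
  then show ?thesis by (auto simp: block_squares_def intro!: sum_list_nonneg)
qed

lemma square_sum_le_square_variation: "(sum_list xs)\<^sup>2 \<le> square_variation xs"
proof (cases "xs = []")
  case False
  then show ?thesis
    using square_variation_upper[of "[xs]" xs] by (simp add: partitions_def block_squares_def)
qed (simp add: square_variation_nonneg)

lemma square_variation_append: "square_variation xs + square_variation ys \<le> square_variation (xs @ ys)"
proof -
  obtain us where us: "us \<in> partitions xs" "square_variation xs = block_squares us"
    by (rule square_variation_attained)
  obtain vs where vs: "vs \<in> partitions ys" "square_variation ys = block_squares vs"
    by (rule square_variation_attained)
  have "us @ vs \<in> partitions (xs @ ys)"
    using us vs by (auto simp: partitions_def)
  then show ?thesis
    using square_variation_upper us vs by (fastforce simp: block_squares_def)
qed

lemma square_variation_concat: "(\<Sum>w\<leftarrow>W. square_variation w) \<le> square_variation (concat W)"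
proof (induction W)
  case (Cons w W)
  then show ?case using square_variation_append[of w "concat W"] by simp
qed (simp add: square_variation_nonneg)

text \<open>
  Large displacement and moderate variation occur together with probability bounded below.
  The second and fourth moments of the displacement \<open>S\<close> are \<open>n\<close> and less than \<open>3 * n\<^sup>2\<close>, so
  \<open>S\<^sup>2 \<ge> n / 2\<close> with probability at least \<open>1/12\<close>; by Markov's inequality the variation exceeds
  \<open>24 * C * n\<close> with probability at most \<open>1/24\<close>. Of the two possible signs of \<open>S\<close> the more frequent
  one is kept, so that the displacements of several walks in \<open>G\<close> add up without cancellation.
\<close>
lemma large_walks_of_small_variation:
  assumes "0 < C" "0 < n" and bound: "(\<Sum>xs\<in>cube n. square_variation xs) \<le> C * n * 2 ^ n"
  obtains G where "G \<subseteq> cube n" "2 ^ n \<le> 48 * real (card G)"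
    "\<And>xs. xs \<in> G \<Longrightarrow> square_variation xs \<le> 24 * C * n"
    "\<And>W. set W \<subseteq> G \<Longrightarrow> n / 2 * (length W)\<^sup>2 \<le> (sum_list (concat W))\<^sup>2"
proof -
  define G where "G = {xs \<in> cube n. n / 2 \<le> (sum_list xs)\<^sup>2 \<and> square_variation xs \<le> 24 * C * n}"
  have fin: "finite (cube n)" by (simp add: finite_words)
  have n: "real n > 0" using assms by simp
  have "(\<Sum>xs\<in>cube n. (sum_list xs)\<^sup>2) \<le>
      (\<Sum>xs\<in>cube n. n / 2 + 3 * n * indicat_real G xs + square_variation xs / (8 * C) + (sum_list xs) ^ 4 / (12 * n))"
  proof (rule sum_mono)
    fix xs assume xs: "xs \<in> cube n"
    let ?S = "(sum_list xs)\<^sup>2"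
    \<comment> \<open>The inequality of the means with the weight that makes the fourth moment cost
      only \<open>n / 4\<close> per walk on average.\<close>
    have "0 \<le> (?S - 6 * n)\<^sup>2" by simp
    then have amgm: "?S \<le> 3 * n + (sum_list xs) ^ 4 / (12 * n)"
      using n by (simp add: field_simps power2_eq_square power4_eq_xxxx)
    have v: "0 \<le> square_variation xs / (8 * C)" using assms square_variation_nonneg by simp
    have q: "0 \<le> (sum_list xs) ^ 4 / (12 * n)" by simp
    have i: "0 \<le> 3 * n * indicat_real G xs" by simp
    consider "?S < n / 2" | "xs \<in> G" | "24 * C * n < square_variation xs"
      using xs by (force simp: G_def)
    then show "?S \<le> n / 2 + 3 * n * indicat_real G xs + square_variation xs / (8 * C) + (sum_list xs) ^ 4 / (12 * n)"
    proof cases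
      case 1
      then show ?thesis using v q i by linarith
    next
      case 2
      then have "3 * n * indicat_real G xs = 3 * n" by simp
      then show ?thesis using v n amgm by linarith
    next
      case 3
      then have "3 * n \<le> square_variation xs / (8 * C)" using assms by (simp add: field_simps)
      then show ?thesis using amgm n i by linarith
    qed
  qed
  also have "\<dots> = n / 2 * 2 ^ n + 3 * n * card G + (\<Sum>xs\<in>cube n. square_variation xs) / (8 * C)
      + (\<Sum>xs\<in>cube n. (sum_list xs) ^ 4) / (12 * n)"
  proof -
    have "(\<Sum>xs\<in>cube n. indicat_real G xs) = card G"
      using fin by (simp add: indicator_def sum.If_cases G_def Int_def conj_ac)
    then show ?thesis
      by (simp add: sum.distrib card_cube flip: sum_distrib_left sum_divide_distrib)
  qed
  also have "(\<Sum>xs\<in>cube n. square_variation xs) / (8 * C) \<le> n / 8 * 2 ^ n"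
    using bound assms by (simp add: field_simps)
  also have "(\<Sum>xs\<in>cube n. (sum_list xs) ^ 4) / (12 * n) \<le> n / 4 * 2 ^ n"
    using n unfolding sum_cube_fourth by (simp add: field_simps power2_eq_square)
  finally have "n * 2 ^ n \<le> n * (24 * real (card G))"
    unfolding sum_cube_square by (simp add: field_simps)
  then have "2 ^ n \<le> 24 * real (card G)" using n by simp
  define Gp Gm where "Gp = {xs \<in> G. 0 \<le> sum_list xs}" and "Gm = {xs \<in> G. sum_list xs < 0}"
  have "finite G" using fin by (auto simp: G_def)
  then have "card Gp + card Gm = card G"
    by (subst card_Un_disjoint[symmetric]) (auto simp: Gp_def Gm_def intro!: arg_cong[where f=card])
  then consider "card G \<le> 2 * card Gp" | "card G \<le> 2 * card Gm" by linarith
  then show ?thesis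
  proof cases
    case 1
    show ?thesis
    proof (rule that[of Gp])
      show "Gp \<subseteq> cube n" by (auto simp: Gp_def G_def)
      show "2 ^ n \<le> 48 * real (card Gp)" using 1 \<open>2 ^ n \<le> _\<close> by simp
      show "square_variation xs \<le> 24 * C * n" if "xs \<in> Gp" for xs using that by (auto simp: Gp_def G_def)
      fix W assume "set W \<subseteq> Gp"
      then have "sqrt (n / 2) * length W \<le> sum_list (concat W)"
      proof (induction W)
        case (Cons w W)
        then have "sqrt (n / 2) \<le> sum_list w"
          by (intro real_le_lsqrt) (auto simp: Gp_def G_def)
        with Cons show ?case by (simp add: algebra_simps)
      qed simp
      then have "(sqrt (n / 2) * length W)\<^sup>2 \<le> (sum_list (concat W))\<^sup>2"
        by (intro power_mono) auto
      then show "n / 2 * (length W)\<^sup>2 \<le> (sum_list (concat W))\<^sup>2"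
        by (simp add: power_mult_distrib)
    qed
  next
    case 2
    show ?thesis
    proof (rule that[of Gm])
      show "Gm \<subseteq> cube n" by (auto simp: Gm_def G_def)
      show "2 ^ n \<le> 48 * real (card Gm)" using 2 \<open>2 ^ n \<le> _\<close> by simp
      show "square_variation xs \<le> 24 * C * n" if "xs \<in> Gm" for xs using that by (auto simp: Gm_def G_def)
      fix W assume "set W \<subseteq> Gm"
      then have "sqrt (n / 2) * length W \<le> - sum_list (concat W)"
      proof (induction W)
        case (Cons w W)
        then have "sqrt (n / 2) \<le> - sum_list w"
          by (intro real_le_lsqrt) (auto simp: Gm_def G_def)
        with Cons show ?case by (simp add: algebra_simps)
      qed simp
      then have "(sqrt (n / 2) * length W)\<^sup>2 \<le> (- sum_list (concat W))\<^sup>2"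
        by (intro power_mono) auto
      then show "n / 2 * (length W)\<^sup>2 \<le> (sum_list (concat W))\<^sup>2"
        by (simp add: power_mult_distrib)
    qed
  qed
qed

text \<open>
  Cutting a walk of length \<open>l * n\<close> into \<open>l\<close> pieces and adding their variations reproduces the mean
  \<open>c\<close> per step. If all pieces lie in the set \<open>G\<close> of walks with large displacement and small
  variation, the single jump across the whole walk does better than the pieces by at least
  \<open>l * n\<close>, because \<open>l\<^sup>2 * n / 2\<close> beats \<open>24 * C * l * n\<close>; this happens with probability at least
  \<open>(1/48)\<^sup>l\<close>.
\<close>
lemma square_variation_increment:
  assumes "0 < C" "0 < n" and bound: "(\<Sum>xs\<in>cube n. square_variation xs) \<le> C * n * 2 ^ n"
    and l: "48 * C + 2 \<le> real l" and lower: "c * n * 2 ^ n \<le> (\<Sum>xs\<in>cube n. square_variation xs)"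
  shows "(c + (1/48) ^ l) * real (l * n) * 2 ^ (l * n) \<le> (\<Sum>xs\<in>cube (l * n). square_variation xs)"
proof -
  obtain G where G: "G \<subseteq> cube n" "2 ^ n \<le> 48 * real (card G)"
    "\<And>xs. xs \<in> G \<Longrightarrow> square_variation xs \<le> 24 * C * n"
    "\<And>W. set W \<subseteq> G \<Longrightarrow> n / 2 * (length W)\<^sup>2 \<le> (sum_list (concat W))\<^sup>2"
    using large_walks_of_small_variation[OF assms(1-3)] by metis
  have fin: "finite (cube n)" by (simp add: finite_words)
  then have finG: "finite G" using G(1) finite_subset by blast
  have sub: "words G l \<subseteq> words (cube n) l" using G(1) by (auto simp: words_def)
  have pos: "0 < real l" using l assms by linarith
  have gain: "(\<Sum>w\<leftarrow>W. square_variation w) + l * n \<le> square_variation (concat W)" if W: "W \<in> words G l" for W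
  proof -
    have W': "set W \<subseteq> G" "length W = l" using W by (auto simp: words_def)
    have "(\<Sum>w\<leftarrow>W. square_variation w) \<le> (\<Sum>w\<leftarrow>W. 24 * C * n)"
      using W' G(3) by (intro sum_list_mono) auto
    also have "\<dots> = l * (24 * C * n)"
      using W' by (simp add: sum_list_triv)
    finally have "(\<Sum>w\<leftarrow>W. square_variation w) + l * n \<le> l * n * (24 * C + 1)"
      by (simp add: algebra_simps)
    also have "\<dots> \<le> l * n * (l / 2)"
      using l by (intro mult_left_mono) auto
    also have "\<dots> = n / 2 * (length W)\<^sup>2"
      using W' by (simp add: power2_eq_square)
    also have "\<dots> \<le> (sum_list (concat W))\<^sup>2"
      using G(4) W' by blast
    also have "\<dots> \<le> square_variation (concat W)"
      by (rule square_sum_le_square_variation)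
    finally show ?thesis .
  qed
  have add: "(\<Sum>W\<in>words (cube n) l. \<Sum>w\<leftarrow>W. square_variation w) * 2 ^ n
      = l * (2 ^ n) ^ l * (\<Sum>xs\<in>cube n. square_variation xs)"
    using sum_words_additive[OF fin, of square_variation l] by (simp add: card_cube)
  have "c * (l * n) * (2 ^ n) ^ l * 2 ^ n = l * (2 ^ n) ^ l * (c * n * 2 ^ n)"
    by (simp add: algebra_simps)
  also have "\<dots> \<le> l * (2 ^ n) ^ l * (\<Sum>xs\<in>cube n. square_variation xs)"
    by (intro mult_left_mono lower) simp
  also note add[symmetric]
  finally have blocks: "c * (l * n) * (2 ^ n) ^ l \<le> (\<Sum>W\<in>words (cube n) l. \<Sum>w\<leftarrow>W. square_variation w)"
    by simp
  have "(1/48) ^ l * (2 ^ n) ^ l = ((2 ^ n / 48) ^ l :: real)"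
    by (simp add: power_divide)
  also have "\<dots> \<le> real (card G) ^ l"
    using G(2) by (intro power_mono) auto
  finally have cardG: "(1/48) ^ l * (2 ^ n) ^ l \<le> real (card (words G l))"
    using finG by (simp add: card_words)
  have "(c + (1/48) ^ l) * real (l * n) * 2 ^ (l * n)
      = c * (l * n) * (2 ^ n) ^ l + l * n * ((1/48) ^ l * (2 ^ n) ^ l)"
    by (simp add: algebra_simps power_mult[symmetric])
  also have "\<dots> \<le> (\<Sum>W\<in>words (cube n) l. \<Sum>w\<leftarrow>W. square_variation w) + l * n * card (words G l)"
    using cardG by (intro add_mono blocks) (simp add: mult_left_mono)
  also have "l * n * card (words G l) = (\<Sum>W\<in>words (cube n) l. l * n * indicator (words G l) W)"
    using sub finite_words[OF fin, of l]
    by (simp add: sum_indicator_eq_card Int_absorb1 flip: sum_distrib_left)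
  also have "(\<Sum>W\<in>words (cube n) l. \<Sum>w\<leftarrow>W. square_variation w) + real \<dots>
      = (\<Sum>W\<in>words (cube n) l. (\<Sum>w\<leftarrow>W. square_variation w) + real (l * n * indicator (words G l) W))"
    by (simp add: sum.distrib)
  also have "\<dots> \<le> (\<Sum>W\<in>words (cube n) l. square_variation (concat W))"
  proof (rule sum_mono)
    fix W
    show "(\<Sum>w\<leftarrow>W. square_variation w) + real (l * n * indicator (words G l) W) \<le> square_variation (concat W)"
      using gain[of W] square_variation_concat[of W] by (cases "W \<in> words G l") auto
  qed
  also have "\<dots> = (\<Sum>xs\<in>cube (l * n). square_variation xs)"
    by (rule sum_words_concat[symmetric])
  finally show ?thesis .
qed

text \<open>
  If the mean variation per step were at most \<open>D\<close> for all lengths, the increment \<open>\<delta>\<close> could be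
  gained arbitrarily often with one and the same \<open>l\<close>.
\<close>
lemma square_variation_unbounded:
  fixes C :: real
  obtains n where "0 < n" "C * n * 2 ^ n \<le> (\<Sum>xs\<in>cube n. square_variation xs)"
proof (rule ccontr)
  note elim = that
  assume no: "\<not> thesis"
  have no: "(\<Sum>xs\<in>cube n. square_variation xs) \<le> C * n * 2 ^ n" if "0 < n" for n
    using no \<open>0 < n\<close> elim by (meson linear)
  define D where "D = max C 1"
  have bound: "(\<Sum>xs\<in>cube n. square_variation xs) \<le> D * n * 2 ^ n" if "0 < n" for n
  proof -
    have "(\<Sum>xs\<in>cube n. square_variation xs) \<le> C * n * 2 ^ n"
      using that by (rule no)
    also have "\<dots> \<le> D * n * 2 ^ n" by (simp add: D_def mult_right_mono)
    finally show ?thesis .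
  qed
  obtain l :: nat where l: "48 * D + 2 \<le> l" using real_arch_simple by blast
  define \<delta> :: real where "\<delta> = (1/48) ^ l"
  have "\<exists>n>0. (i * \<delta>) * n * 2 ^ n \<le> (\<Sum>xs\<in>cube n. square_variation xs)" for i :: nat
  proof (induction i)
    case 0
    show ?case by (intro exI[of _ 1]) (simp add: sum_nonneg square_variation_nonneg)
  next
    case (Suc i)
    then obtain n where n: "0 < n" "(i * \<delta>) * n * 2 ^ n \<le> (\<Sum>xs\<in>cube n. square_variation xs)" by blast
    have "(i * \<delta> + \<delta>) * real (l * n) * 2 ^ (l * n) \<le> (\<Sum>xs\<in>cube (l * n). square_variation xs)"
      unfolding \<delta>_def
      by (rule square_variation_increment[OF _ n(1) bound[OF n(1)] l])
         (use n(2) in \<open>auto simp: D_def \<delta>_def\<close>)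
    moreover have "0 < l" using l by (cases l) (auto simp: D_def)
    ultimately show ?case
      using n by (intro exI[of _ "l * n"]) (simp add: algebra_simps)
  qed
  moreover obtain i :: nat where "D / \<delta> < i" using reals_Archimedean2 by blast
  ultimately obtain n where n: "0 < n" "(i * \<delta>) * n * 2 ^ n \<le> (\<Sum>xs\<in>cube n. square_variation xs)" by blast
  have "D < i * \<delta>" using \<open>D / \<delta> < i\<close> by (simp add: \<delta>_def field_simps)
  then have "D * (real n * 2 ^ n) < i * \<delta> * (real n * 2 ^ n)"
    using n by (intro mult_strict_right_mono) auto
  then show False using n bound[OF n(1)] by (simp only: mult.assoc)
qed

section \<open>Square means of nested square waves\<close>

text \<open>
  The factor \<open>B\<close> is odd, so that all scales are. The other factor is adapted to the
  averages over \<open>2 * s\<close> squares with \<open>s = scale B k\<close>, which reach back by \<open>4 * s\<^sup>2\<close>: the points of a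
  block of length \<open>scale B (Suc k)\<close> with distance less than \<open>s * (4 * s + 1)\<close> from its left end make
  up exactly the fraction \<open>1 / B\<close> of the block.
\<close>
fun scale :: "nat \<Rightarrow> nat \<Rightarrow> nat" where
  "scale B 0 = 1"
| "scale B (Suc k) = scale B k * ((4 * scale B k + 1) * B)"

lemma scale_pos: "0 < B \<Longrightarrow> 0 < scale B k"
  by (induction k) auto

lemma odd_scale: "odd B \<Longrightarrow> odd (scale B k)"
  by (induction k) auto

lemma scale_dvd: "i \<le> j \<Longrightarrow> scale B i dvd scale B j"
  by (induction j) (auto simp: le_Suc_eq)

lemma strict_mono_scale: "0 < B \<Longrightarrow> strict_mono (scale B)"
proof (rule strict_monoI_Suc)
  fix k assume "0 < B"
  then have "0 < scale B k" by (rule scale_pos)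
  then have "scale B k * 1 < scale B k * ((4 * scale B k + 1) * B)"
    using mult_le_mono2[of 1 B "4 * scale B k + 1"] \<open>0 < B\<close>
    by (intro mult_strict_left_mono) auto
  then show "scale B k < scale B (Suc k)" by simp
qed

declare scale.simps(2) [simp del]

definition wave :: "nat \<Rightarrow> nat \<Rightarrow> real" where
  "wave s m = (if even (m div s) then 1 else -1)"

lemma abs_wave [simp]: "\<bar>wave s m\<bar> = 1"
  by (simp add: wave_def)

text \<open>
  For odd \<open>s\<close> the number \<open>(i + s)\<^sup>2 - i\<^sup>2 = s * (s + 2 * i)\<close> is an odd multiple of \<open>s\<close>, and a shift by an
  odd multiple of \<open>s\<close> flips the wave. So two adjacent runs of \<open>s\<close> summands cancel.
\<close>
lemma sum_wave_squares_eq_0: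
  assumes "odd s" "2 * s dvd N" "N\<^sup>2 \<le> m"
  shows "(\<Sum>i=1..N. wave s (m - i\<^sup>2)) = 0"
proof -
  have s: "0 < s" using assms(1) by (rule odd_pos)
  have flip: "wave s (m - (i + s)\<^sup>2) = - wave s (m - i\<^sup>2)" if "i + s \<le> N" for i
  proof -
    have "(i + s)\<^sup>2 \<le> N\<^sup>2" using that by (rule power_mono) simp
    then have le: "(i + s)\<^sup>2 \<le> m" using assms(3) by (rule order.trans)
    moreover have "(i + s)\<^sup>2 = i\<^sup>2 + s * (s + 2 * i)" by (simp add: power2_eq_square algebra_simps)
    ultimately have "m - i\<^sup>2 = (m - (i + s)\<^sup>2) + s * (s + 2 * i)" by simp
    then have "(m - i\<^sup>2) div s = (m - (i + s)\<^sup>2) div s + (s + 2 * i)" using s by simp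
    then show ?thesis using assms(1) by (simp add: wave_def)
  qed
  obtain t where t: "N = 2 * s * t" using assms(2) by (rule dvdE)
  have "(\<Sum>i=1..2 * s * u. wave s (m - i\<^sup>2)) = 0" if "u \<le> t" for u
    using that
  proof (induction u)
    case (Suc u)
    have "2 * s * Suc u \<le> N" unfolding t using Suc.prems by (intro mult_le_mono2)
    then have b: "2 * s * u + 2 * s \<le> N" by simp
    let ?g = "\<lambda>i. wave s (m - i\<^sup>2)"
    let ?a = "2 * s * u"
    have "(\<Sum>i=1..2 * s * Suc u. ?g i)
        = (\<Sum>i=1..?a. ?g i) + (\<Sum>i=?a + 1..?a + s. ?g i) + (\<Sum>i=?a + s + 1..?a + s + s. ?g i)"
      using sum.ub_add_nat[of 1 ?a ?g s] sum.ub_add_nat[of 1 "?a + s" ?g s]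
      by (simp add: algebra_simps)
    also have "(\<Sum>i=?a + s + 1..?a + s + s. ?g i) = (\<Sum>i=?a + 1..?a + s. ?g (i + s))"
      using sum.shift_bounds_cl_nat_ivl[of ?g "?a + 1" s "?a + s"] by (simp add: algebra_simps)
    also have "\<dots> = (\<Sum>i=?a + 1..?a + s. - ?g i)"
      using b by (intro sum.cong refl flip) auto
    finally show ?case using Suc by (simp add: sum_negf)
  qed simp
  then show ?thesis using t by blast
qed

text \<open>
  The points of the block with index \<open>b\<close> at level \<open>Suc k\<close> that keep, at all levels up to this one,
  a distance from the left end of their block that the averages do not exceed.
\<close>
definition deep :: "nat \<Rightarrow> nat \<Rightarrow> nat \<Rightarrow> nat set" where
  "deep B k b = {m. m div scale B (Suc k) = b \<and>
     (\<forall>i\<le>k. scale B i * (4 * scale B i + 1) \<le> m mod scale B (Suc i))}"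

definition signs :: "nat \<Rightarrow> nat \<Rightarrow> nat \<Rightarrow> real list" where
  "signs B k m = map (\<lambda>i. wave (scale B (Suc i)) m) [0..<k]"

definition signal :: "nat \<Rightarrow> nat \<Rightarrow> nat \<Rightarrow> real" where
  "signal B n m = sum_list (signs B n m)"

lemma signal_eq_sum: "signal B n m = (\<Sum>i<n. wave (scale B (Suc i)) m)"
  by (simp add: signal_def signs_def sum_list_sum_nth atLeast0LessThan)

text \<open>
  The average over the first \<open>N = 2 * scale B j\<close> squares removes the first \<open>j\<close> waves, whose periods
  divide \<open>N\<close>, and does not affect the other ones at a deep point, since there the shifts by at most
  \<open>N\<^sup>2\<close> do not leave the blocks on which these waves are constant.
\<close>
lemma square_mean_signal:
  assumes "odd B" "m \<in> deep B n 0" "j \<le> n"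
  defines "N \<equiv> 2 * scale B j"
  shows "N\<^sup>2 \<le> m"
    and "(\<Sum>i=1..N. signal B n (m - i\<^sup>2)) = N * sum_list (drop j (signs B n m))"
proof -
  have B: "0 < B" using assms(1) by (rule odd_pos)
  have N: "N\<^sup>2 \<le> m mod scale B (Suc k)" if "j \<le> k" "k \<le> n" for k
  proof -
    have "scale B j \<le> scale B k"
      using that strict_mono_scale[OF B] by (simp add: strict_mono_less_eq)
    then have "N\<^sup>2 \<le> (2 * scale B k)\<^sup>2" by (simp add: N_def power_mono)
    also have "\<dots> \<le> scale B k * (4 * scale B k + 1)" by (simp add: power2_eq_square)
    also have "\<dots> \<le> m mod scale B (Suc k)" using assms(2) that by (auto simp: deep_def)
    finally show ?thesis .
  qed
  show Nm: "N\<^sup>2 \<le> m"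
    using N[OF assms(3)] order.trans mod_less_eq_dividend by blast
  have slow: "(\<Sum>i=1..N. wave (scale B (Suc k)) (m - i\<^sup>2)) = N * wave (scale B (Suc k)) m"
    if "j \<le> k" "k < n" for k
  proof -
    let ?s = "scale B (Suc k)"
    have "wave ?s (m - i\<^sup>2) = wave ?s m" if i: "i \<in> {1..N}" for i
    proof -
      have "i\<^sup>2 \<le> N\<^sup>2" using i by (intro power_mono) auto
      then have le: "i\<^sup>2 \<le> m mod ?s" using N[of k] \<open>j \<le> k\<close> \<open>k < n\<close> by linarith
      have "m - i\<^sup>2 = ?s * (m div ?s) + (m mod ?s - i\<^sup>2)"
        using le mult_div_mod_eq[of ?s m] by linarith
      moreover have "m mod ?s - i\<^sup>2 < ?s"
        using scale_pos[OF B, of "Suc k"] by (meson less_imp_diff_less mod_less_divisor)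
      ultimately have "(m - i\<^sup>2) div ?s = m div ?s" by simp
      then show ?thesis by (simp add: wave_def)
    qed
    then show ?thesis by simp
  qed
  have fast: "(\<Sum>i=1..N. wave (scale B (Suc k)) (m - i\<^sup>2)) = 0" if "k < j" for k
    using that Nm assms(1)
    by (intro sum_wave_squares_eq_0 odd_scale) (auto simp: N_def intro!: mult_dvd_mono scale_dvd)
  have "(\<Sum>i=1..N. signal B n (m - i\<^sup>2)) = (\<Sum>k<n. \<Sum>i=1..N. wave (scale B (Suc k)) (m - i\<^sup>2))"
    unfolding signal_eq_sum by (rule sum.swap)
  also have "\<dots> = (\<Sum>k\<in>{j..<n}. \<Sum>i=1..N. wave (scale B (Suc k)) (m - i\<^sup>2))"
    using fast by (intro sum.mono_neutral_right) (auto simp: not_le)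
  also have "\<dots> = (\<Sum>k\<in>{j..<n}. N * wave (scale B (Suc k)) m)"
    using slow by (intro sum.cong) auto
  also have "\<dots> = N * sum_list (drop j (signs B n m))"
    by (simp add: signs_def drop_map drop_upt sum_distrib_left interv_sum_list_conv_sum_set_nat)
  finally show "(\<Sum>i=1..N. signal B n (m - i\<^sup>2)) = N * sum_list (drop j (signs B n m))" .
qed

lemma sum_parity_balanced:
  fixes g :: "real \<Rightarrow> real"
  shows "(\<Sum>d\<in>{a..<a + 2 * h}. g (if even (e + d :: nat) then 1 else -1)) = h * (g 1 + g (-1))"
proof (induction h)
  case (Suc h)
  let ?f = "\<lambda>d. g (if even (e + d) then 1 else -1)"
  have "?f (a + 2 * h) + ?f (Suc (a + 2 * h)) = g 1 + g (-1)"
    by simp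
  moreover have "sum ?f {a..<a + 2 * Suc h} = sum ?f {a..<a + 2 * h} + (?f (a + 2 * h) + ?f (Suc (a + 2 * h)))"
    by (simp del: even_add)
  ultimately show ?case
    unfolding Suc.IH by (simp only: of_nat_Suc distrib_right mult_1)
qed simp

lemma le_mod_mult_iff:
  fixes s p t m :: nat
  assumes "0 < s"
  shows "s * t \<le> m mod (s * p) \<longleftrightarrow> t \<le> (m div s) mod p"
proof -
  have "m mod (s * p) = s * ((m div s) mod p) + m mod s"
    by (rule mod_mult2_eq)
  then have "(m mod (s * p)) div s = (m div s) mod p"
    using assms by simp
  then show ?thesis
    using less_eq_div_iff_mult_less_eq[OF assms, of t "m mod (s * p)"] by (simp only: mult.commute)
qed

lemma div_mult_eq_and_le_mod_iff:
  fixes s p t m b :: nat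
  assumes "0 < p"
  shows "m div (s * p) = b \<and> t \<le> (m div s) mod p \<longleftrightarrow> (\<exists>d\<in>{t..<p}. m div s = b * p + d)"
proof
  assume "m div (s * p) = b \<and> t \<le> (m div s) mod p"
  moreover have "m div s = (m div s) div p * p + (m div s) mod p" by simp
  ultimately show "\<exists>d\<in>{t..<p}. m div s = b * p + d"
    using assms by (intro bexI[of _ "(m div s) mod p"]) (simp_all add: div_mult2_eq)
next
  assume "\<exists>d\<in>{t..<p}. m div s = b * p + d"
  then show "m div (s * p) = b \<and> t \<le> (m div s) mod p"
    by (auto simp: div_mult2_eq)
qed

text \<open>
  A block of level \<open>k + 2\<close> consists of \<open>p\<close> blocks of level \<open>k + 1\<close>. The distance condition at the
  top level excludes precisely the first \<open>4 * scale B (Suc k) + 1\<close> of these.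
\<close>
lemma deep_Suc:
  fixes k b B defines "p \<equiv> (4 * scale B (Suc k) + 1) * B"
  assumes B: "0 < B"
  shows "deep B (Suc k) b = (\<Union>d\<in>{4 * scale B (Suc k) + 1..<p}. deep B k (b * p + d))"
proof -
  let ?s = "scale B (Suc k)"
  have s: "0 < ?s" using B by (rule scale_pos)
  have p: "0 < p" using B by (simp add: p_def)
  have S: "scale B (Suc (Suc k)) = ?s * p" unfolding p_def by (rule scale.simps(2))
  have split: "(\<forall>i\<le>Suc k. P i) \<longleftrightarrow> P (Suc k) \<and> (\<forall>i\<le>k. P i)" for P
    by (auto simp: le_Suc_eq)
  have deep_iff: "m \<in> deep B (Suc k) b \<longleftrightarrow>
      (m div (?s * p) = b \<and> ?s * (4 * ?s + 1) \<le> m mod (?s * p)) \<and>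
      (\<forall>i\<le>k. scale B i * (4 * scale B i + 1) \<le> m mod scale B (Suc i))" for m
    unfolding deep_def mem_Collect_eq S split by simp
  show ?thesis
  proof (rule set_eqI)
    fix m
    show "m \<in> deep B (Suc k) b \<longleftrightarrow> m \<in> (\<Union>d\<in>{4 * ?s + 1..<p}. deep B k (b * p + d))"
      unfolding deep_iff le_mod_mult_iff[OF s] div_mult_eq_and_le_mod_iff[OF p]
      by (simp add: deep_def)
  qed
qed

lemma finite_deep: "0 < B \<Longrightarrow> finite (deep B k b)"
proof (rule finite_subset)
  assume "0 < B"
  then have s: "0 < scale B (Suc k)" by (rule scale_pos)
  show "deep B k b \<subseteq> {..<scale B (Suc k) * (b + 1)}"
  proof
    fix m assume "m \<in> deep B k b"
    then have "m div scale B (Suc k) < b + 1" by (auto simp: deep_def)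
    then show "m \<in> {..<scale B (Suc k) * (b + 1)}"
      using s by (simp only: lessThan_iff div_less_iff_less_mult mult.commute)
  qed
qed simp

lemma div_eq_and_le_mod_iff:
  fixes m c b t :: nat
  assumes "0 < c"
  shows "m div c = b \<and> t \<le> m mod c \<longleftrightarrow> c * b + t \<le> m \<and> m < c * b + c"
proof
  assume "m div c = b \<and> t \<le> m mod c"
  then show "c * b + t \<le> m \<and> m < c * b + c"
    using mult_div_mod_eq[of c m] mod_less_divisor[OF assms, of m] by auto
next
  assume m: "c * b + t \<le> m \<and> m < c * b + c"
  define r where "r = m - c * b"
  have "m = c * b + r" "t \<le> r" "r < c" using m by (auto simp: r_def)
  then show "m div c = b \<and> t \<le> m mod c" by simp
qed

text \<open>
  On the deep points of a block all sign patterns are equally frequent. The last sign of a pattern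
  is the parity of the index of the sub-block; the deep points lie in \<open>p - (4 * s + 1)\<close> consecutive
  sub-blocks, where \<open>s = scale B (Suc k)\<close>. This number is even because \<open>p\<close> and \<open>4 * s + 1\<close> are odd, so
  both parities occur equally often, and the other signs are distributed in each sub-block
  as the induction hypothesis says.
\<close>
lemma sum_deep:
  fixes F :: "real list \<Rightarrow> real"
  assumes "odd B"
  shows "(\<Sum>m\<in>deep B k b. F (signs B k m))
       = scale B (Suc k) * (1 - 1 / B) ^ Suc k / 2 ^ k * (\<Sum>xs\<in>cube k. F xs)"
proof (induction k arbitrary: b F)
  case 0
  have B: "0 < B" using assms by (rule odd_pos)
  have s1: "scale B (Suc 0) = 5 * B" by (simp add: scale.simps(2))
  have "deep B 0 b = {scale B 1 * b + 5..<scale B 1 * b + scale B 1}"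
    using B by (auto simp: deep_def s1 div_eq_and_le_mod_iff)
  then show ?case
    using B by (simp add: s1 signs_def field_simps of_nat_diff)
next
  case (Suc k)
  have B: "0 < B" using assms by (rule odd_pos)
  let ?s = "scale B (Suc k)"
  define p where "p = (4 * ?s + 1) * B"
  obtain h' where h': "B = 2 * h' + 1" using assms by (rule oddE)
  define h where "h = (4 * ?s + 1) * h'"
  have p: "p = 4 * ?s + 1 + 2 * h" by (simp add: p_def h_def h' algebra_simps)
  let ?c = "?s * (1 - 1 / B) ^ Suc k / 2 ^ k :: real"
  have "(\<Sum>m\<in>deep B (Suc k) b. F (signs B (Suc k) m))
      = (\<Sum>d\<in>{4 * ?s + 1..<p}. \<Sum>m\<in>deep B k (b * p + d). F (signs B (Suc k) m))"
    unfolding deep_Suc[OF B] p_def[symmetric]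
    using finite_deep[OF B] by (intro sum.UNION_disjoint) (auto simp: deep_def)
  also have "\<dots> = (\<Sum>d\<in>{4 * ?s + 1..<p}. \<Sum>m\<in>deep B k (b * p + d).
      F (signs B k m @ [if even (b * p + d) then 1 else -1]))"
    by (intro sum.cong refl) (auto simp: signs_def wave_def deep_def)
  also have "\<dots> = (\<Sum>d\<in>{4 * ?s + 1..<p}. ?c * (\<Sum>xs\<in>cube k. F (xs @ [if even (b * p + d) then 1 else -1])))"
    by (intro sum.cong refl Suc.IH)
  also have "\<dots> = ?c * (\<Sum>d\<in>{4 * ?s + 1..<4 * ?s + 1 + 2 * h}. \<Sum>xs\<in>cube k. F (xs @ [if even (b * p + d) then 1 else -1]))"
    unfolding p by (simp only: sum_distrib_left)
  also have "\<dots> = ?c * (h * ((\<Sum>xs\<in>cube k. F (xs @ [1])) + (\<Sum>xs\<in>cube k. F (xs @ [-1]))))"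
    by (subst sum_parity_balanced) simp
  also have "(\<Sum>xs\<in>cube k. F (xs @ [1])) + (\<Sum>xs\<in>cube k. F (xs @ [-1])) = (\<Sum>xs\<in>cube (Suc k). F xs)"
    by (simp add: sum_words_snoc sum.distrib)
  also have "?c * (h * (\<Sum>xs\<in>cube (Suc k). F xs))
      = scale B (Suc (Suc k)) * (1 - 1 / B) ^ Suc (Suc k) / 2 ^ Suc k * (\<Sum>xs\<in>cube (Suc k). F xs)"
  proof -
    have "2 * real h = (4 * ?s + 1) * B * (1 - 1 / B)"
      using B by (simp add: h_def h' field_simps)
    then have h2: "real h = (4 * ?s + 1) * B * (1 - 1 / B) / 2" by simp
    show ?thesis
      unfolding h2 scale.simps(2)[of B "Suc k"] by (simp add: mult_ac)
  qed
  finally show ?case .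
qed

lemma deep_top: "0 < B \<Longrightarrow> m \<in> deep B n 0 \<Longrightarrow> m < scale B (Suc n)"
  using scale_pos[of B "Suc n"] by (auto simp: deep_def div_eq_0_iff)

text \<open>
  At the deep points the mean energy of the signal is \<open>n\<close> and the mean variation is large
  compared with \<open>n\<close>. The remaining points have density at most \<open>(n + 1) / B\<close>, and the energy there is
  at most \<open>n\<^sup>2\<close>; so a \<open>B\<close> of order \<open>n\<^sup>2\<close> makes their share harmless.
\<close>
lemma signal_energy_vs_variation:
  fixes C :: real
  assumes "0 < C"
  obtains B n where "odd B" "0 < (\<Sum>m<scale B (Suc n). (signal B n m)\<^sup>2)"
    "C * (\<Sum>m<scale B (Suc n). (signal B n m)\<^sup>2) \<le> (\<Sum>m\<in>deep B n 0. square_variation (signs B n m))"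
proof -
  \<comment> \<open>One factor \<open>2\<close> pays for the density of the deep points, the other one for the energy outside them.\<close>
  obtain n where n: "0 < n" "4 * C * n * 2 ^ n \<le> (\<Sum>xs\<in>cube n. square_variation xs)"
    by (rule square_variation_unbounded)
  \<comment> \<open>Odd, and large enough to make both the share of the energy outside the deep points at
    most \<open>n\<close> per point and the density of the deep points at least \<open>1 / 2\<close>.\<close>
  define B where "B = 2 * (n * (n + 1)) + 1"
  have B: "odd B" "0 < B" by (simp_all add: B_def)
  define H where "H = scale B (Suc n)"
  define G where "G = deep B n 0"
  define \<theta> :: real where "\<theta> = (1 - 1 / B) ^ Suc n"
  have H: "0 < H" unfolding H_def by (rule scale_pos[OF B(2)])
  have sub: "G \<subseteq> {..<H}" using deep_top[OF B(2)] by (auto simp: G_def H_def)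
  have fin: "finite G" using sub finite_subset by blast
  have sumG: "(\<Sum>m\<in>G. F (signs B n m)) = H * \<theta> / 2 ^ n * (\<Sum>xs\<in>cube n. F xs)" for F :: "real list \<Rightarrow> real"
    unfolding G_def H_def \<theta>_def using sum_deep[OF B(1)] by simp
  have "1 + real (Suc n) * (- (1 / B)) \<le> (1 + - (1 / B)) ^ Suc n"
    by (rule Bernoulli_inequality) (use B in simp)
  then have \<theta>: "1 - (n + 1) / B \<le> \<theta>" by (simp add: \<theta>_def)
  have "1 * (real n + 1) \<le> real n * (real n + 1)" using n by (intro mult_right_mono) simp_all
  moreover have "real B = 2 * (real n * (real n + 1)) + 1" by (simp add: B_def algebra_simps)
  ultimately have nB: "2 * (real n * (real n + 1)) \<le> B" "2 * (real n + 1) \<le> B" by linarith+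
  have half: "1 / 2 \<le> \<theta>"
    using \<theta> nB(2) B(2) by (intro order.trans[OF _ \<theta>]) (simp add: field_simps)
  have \<theta>1: "\<theta> \<le> 1" unfolding \<theta>_def using B by (intro power_le_one) auto
  have bad: "n * (1 - \<theta>) \<le> 1"
  proof -
    have "n * (1 - \<theta>) \<le> n * ((n + 1) / B)" using \<theta> by (intro mult_left_mono) auto
    also have "\<dots> \<le> 1" using nB(1) B(2) by (simp add: divide_le_eq add.commute)
    finally show ?thesis .
  qed
  have cardG: "real (card G) = H * \<theta>"
    using sumG[of "\<lambda>_. 1"] by (simp add: card_cube)
  have energyG: "(\<Sum>m\<in>G. (signal B n m)\<^sup>2) = real n * (real H * \<theta>)"
    unfolding signal_def using sumG[of "\<lambda>xs. (sum_list xs)\<^sup>2"] by (simp add: sum_cube_square)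
  have "(\<Sum>m\<in>{..<H} - G. (signal B n m)\<^sup>2) \<le> (\<Sum>m\<in>{..<H} - G. (real n)\<^sup>2)"
  proof (rule sum_mono)
    fix m
    have "\<bar>signal B n m\<bar> \<le> (\<Sum>i<n. \<bar>wave (scale B (Suc i)) m\<bar>)"
      unfolding signal_eq_sum by (rule sum_abs)
    also have "\<dots> = n" by simp
    finally show "(signal B n m)\<^sup>2 \<le> (real n)\<^sup>2" by (simp add: abs_le_square_iff[symmetric])
  qed
  also have "\<dots> = (H - H * \<theta>) * (real n)\<^sup>2"
    using sub fin card_mono[OF _ sub] by (simp add: card_Diff_subset of_nat_diff cardG)
  also have "\<dots> = real n * real H * (n * (1 - \<theta>))"
    by (simp add: power2_eq_square algebra_simps)
  also have "\<dots> \<le> real n * real H * 1" using bad by (intro mult_left_mono) auto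
  finally have "(\<Sum>m\<in>{..<H} - G. (signal B n m)\<^sup>2) \<le> real n * real H" by simp
  then have "(\<Sum>m<H. (signal B n m)\<^sup>2) \<le> real n * real H + real n * (real H * \<theta>)"
    using sum.subset_diff[OF sub, of "\<lambda>m. (signal B n m)\<^sup>2"] energyG by simp
  also have "\<dots> \<le> real n * real H + real n * (real H * 1)"
    using \<theta>1 by (intro add_left_mono mult_left_mono) auto
  finally have upper: "(\<Sum>m<H. (signal B n m)\<^sup>2) \<le> 2 * real n * real H" by (simp add: mult.commute)
  have "0 < real n * (real H * \<theta>)" using n H half by simp
  also have "\<dots> \<le> (\<Sum>m<H. (signal B n m)\<^sup>2)"
    unfolding energyG[symmetric] by (intro sum_mono2 sub) auto
  finally have pos: "0 < (\<Sum>m<H. (signal B n m)\<^sup>2)" .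
  have "C * (\<Sum>m<H. (signal B n m)\<^sup>2) \<le> C * (2 * real n * real H)"
    using upper assms by (intro mult_left_mono) simp_all
  also have "\<dots> = H * (1 / 2) / 2 ^ n * (4 * C * n * 2 ^ n)"
    by simp
  also have "\<dots> \<le> H * \<theta> / 2 ^ n * (\<Sum>xs\<in>cube n. square_variation xs)"
    using half n(2) assms
    by (intro mult_mono divide_right_mono mult_left_mono) auto
  also have "\<dots> = (\<Sum>m\<in>G. square_variation (signs B n m))" by (rule sumG[symmetric])
  finally show ?thesis using that[OF B(1)] pos unfolding H_def G_def by blast
qed

section \<open>From partial sums to the variation of functions\<close>

text \<open>
  The times are the cut positions; they are continued past the end with step one, because
  the variation is defined by infinite sequences of times.
\<close>
lemma partition_as_subsequence:
  assumes "yss \<in> partitions xs"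
  defines "S \<equiv> \<lambda>j. sum_list (drop j xs)"
  obtains j where "strict_mono j" "\<And>k. k \<le> length yss \<Longrightarrow> j k \<le> length xs"
    "(\<Sum>k<length yss. (S (j k) - S (j (Suc k)))\<^sup>2) = block_squares yss"
proof -
  have xs: "xs = concat yss" and ne: "[] \<notin> set yss"
    using assms by (auto simp: partitions_def)
  define j where "j k = length (concat (take k yss)) + (k - length yss)" for k
  have j_Suc: "j (Suc k) = j k + length (yss ! k)" if "k < length yss" for k
    using that by (simp add: j_def take_Suc_conv_app_nth)
  have drop: "drop (j k) xs = concat (drop k yss)" if "k \<le> length yss" for k
  proof -
    have "xs = concat (take k yss) @ concat (drop k yss)"
      unfolding xs by (metis append_take_drop_id concat_append)
    moreover have "j k = length (concat (take k yss))" using that by (simp add: j_def)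
    ultimately show ?thesis by (metis append_eq_conv_conj)
  qed
  show ?thesis
  proof (rule that)
    show "strict_mono j"
    proof (rule strict_monoI_Suc)
      fix k
      show "j k < j (Suc k)"
      proof (cases "k < length yss")
        case True
        then have "yss ! k \<noteq> []" using ne nth_mem by metis
        then show ?thesis using j_Suc[OF True] by simp
      next
        case False
        then show ?thesis by (simp add: j_def)
      qed
    qed
    show "j k \<le> length xs" if "k \<le> length yss" for k
    proof -
      have "length (concat (take k yss)) \<le> length (concat (take k yss @ drop k yss))"
        by (simp only: concat_append length_append)
      then show ?thesis using that by (simp add: j_def xs)
    qed
    have "S (j k) - S (j (Suc k)) = sum_list (yss ! k)" if "k < length yss" for k
      using that unfolding S_def
      by (simp add: drop Cons_nth_drop_Suc[symmetric])
    then have "(\<Sum>k<length yss. (S (j k) - S (j (Suc k)))\<^sup>2)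
        = (\<Sum>k<length yss. (sum_list (yss ! k))\<^sup>2)"
      by simp
    then show "(\<Sum>k<length yss. (S (j k) - S (j (Suc k)))\<^sup>2) = block_squares yss"
      by (simp add: block_squares_def sum_list_sum_nth atLeast0LessThan)
  qed
qed

lemma esqrt_ennreal: "0 \<le> r \<Longrightarrow> esqrt (ennreal r) = ennreal (sqrt r)"
  by (simp add: esqrt_def)

lemma esqrt_power2: "(esqrt a)\<^sup>2 = a"
  by (cases a) (simp_all add: esqrt_def ennreal_power)

lemma esqrt_mono: "a \<le> b \<Longrightarrow> esqrt a \<le> esqrt b"
  by (cases a; cases b) (auto simp: esqrt_def top_unique ennreal_leI)

lemma variation2_lower_bound:
  assumes "strict_mono i" "\<And>k. 1 \<le> i k"
  shows "ennreal (\<Sum>k<r. (cmod (F (i k) x - F (i (Suc k)) x))\<^sup>2) \<le> (variation2 F x)\<^sup>2"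
proof -
  let ?d = "\<lambda>k. (cmod (F (i k) x - F (i (Suc k)) x))\<^sup>2"
  have "ennreal (\<Sum>k<r. ?d k) = (\<Sum>k<r. ennreal (?d k))"
    by (simp add: sum_ennreal)
  also have "\<dots> \<le> (\<Sum>k. ennreal (?d k))"
    by (intro sum_le_suminf) auto
  also have "\<dots> = (esqrt (\<Sum>k. ennreal (?d k)))\<^sup>2"
    by (rule esqrt_power2[symmetric])
  also have "\<dots> \<le> (variation2 F x)\<^sup>2"
    unfolding variation2_def using assms by (intro power_mono SUP_upper) auto
  finally show ?thesis .
qed

text \<open>
  A family of functions that runs, at the times \<open>N 0 < N 1 < \<dots>\<close>, through the tail sums of \<open>xs\<close> has at
  least the variation of the path \<open>xs\<close>: the blocks of an optimal partition select the times.
\<close>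
lemma square_variation_le_variation2:
  fixes c :: real
  assumes "\<And>j. j \<le> length xs \<Longrightarrow> F (N j) x = complex_of_real (c * sum_list (drop j xs))"
    and "strict_mono N" "\<And>j. 1 \<le> N j"
  shows "ennreal (c\<^sup>2 * square_variation xs) \<le> (variation2 F x)\<^sup>2"
proof -
  obtain yss where yss: "yss \<in> partitions xs" "square_variation xs = block_squares yss"
    by (rule square_variation_attained)
  obtain j where j: "strict_mono j" "\<And>k. k \<le> length yss \<Longrightarrow> j k \<le> length xs"
    "(\<Sum>k<length yss. (sum_list (drop (j k) xs) - sum_list (drop (j (Suc k)) xs))\<^sup>2) = block_squares yss"
    using partition_as_subsequence[OF yss(1)] by blast
  have "(cmod (F (N (j k)) x - F (N (j (Suc k))) x))\<^sup>2
      = c\<^sup>2 * (sum_list (drop (j k) xs) - sum_list (drop (j (Suc k)) xs))\<^sup>2" if "k < length yss" for k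
  proof -
    have "F (N (j k)) x - F (N (j (Suc k))) x
        = complex_of_real (c * (sum_list (drop (j k) xs) - sum_list (drop (j (Suc k)) xs)))"
      using that by (simp add: assms(1) j(2) algebra_simps)
    then show ?thesis by (simp only: norm_of_real power2_abs power_mult_distrib)
  qed
  then have "(\<Sum>k<length yss. (cmod (F (N (j k)) x - F (N (j (Suc k))) x))\<^sup>2) = c\<^sup>2 * square_variation xs"
    unfolding yss(2) j(3)[symmetric] by (simp add: sum_distrib_left)
  moreover have "strict_mono (\<lambda>k. N (j k))"
    using assms(2) j(1) by (simp add: strict_mono_def)
  ultimately show ?thesis
    using variation2_lower_bound[of "\<lambda>k. N (j k)" F x "length yss"] assms(3) by simp
qed

section \<open>Towers\<close>

text \<open>
  Let \<open>q = K!\<close>. As \<open>\<tau> q\<close> moves some set \<open>A\<close> essentially, there is a set \<open>E0\<close> of positive measure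
  whose points lie in \<open>A\<close> but are moved out of \<open>A\<close> by \<open>\<tau> q\<close> (or the same with the complement of
  \<open>A\<close>). For \<open>i \<le> K\<close> the number \<open>q\<close> is a multiple of \<open>i\<close>, so the orbit of such a point under \<open>\<tau> i\<close>
  leaves \<open>A\<close> at some step \<open>j < q div i\<close>. The points with a given \<open>j\<close> form a set without return
  under \<open>\<tau> i\<close>, as \<open>\<tau> i\<close> shifts the exit time, and one of these finitely many sets meets
  the set found for smaller \<open>i\<close> in positive measure. Absence of returns passes to subsets, so this
  can be repeated for \<open>i = 1, \<dots>, K\<close>.
\<close>
lemma exists_set_without_short_returns:
  assumes act: "measure_preserving_int_action M \<tau>" and faithful: "essentially_faithful M \<tau>"
  obtains E where "E \<in> sets M" "0 < emeasure M E"
    "\<And>x i. x \<in> E \<Longrightarrow> 1 \<le> i \<Longrightarrow> i \<le> K \<Longrightarrow> \<tau> (int i) x \<notin> E"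
proof -
  have meas: "\<tau> y \<in> M \<rightarrow>\<^sub>M M" for y
    using act by (auto simp: measure_preserving_int_action_def)
  have zero: "\<tau> 0 x = x" if "x \<in> space M" for x
    using act that by (auto simp: measure_preserving_int_action_def)
  have add: "\<tau> (y + z) x = \<tau> y (\<tau> z x)" if "x \<in> space M" for x y z
    using act that by (auto simp: measure_preserving_int_action_def)
  define q :: nat where "q = fact K"
  have "int q \<noteq> 0" by (simp add: q_def)
  then obtain A where A: "A \<in> sets M"
    "0 < emeasure M (sym_diff A (\<tau> (int q) -` A \<inter> space M))"
    using faithful unfolding essentially_faithful_def by blast
  define T where "T = \<tau> (int q) -` A \<inter> space M"
  have T: "T \<in> sets M" unfolding T_def using meas A(1) by (rule measurable_sets)
  have "emeasure M (sym_diff A T) \<le> emeasure M (A - T) + emeasure M (T - A)"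
    using A T by (intro emeasure_subadditive) auto
  then have "0 < emeasure M (A - T) \<or> 0 < emeasure M (T - A)"
    using A(2) unfolding T_def[symmetric] by (auto simp: zero_less_iff_neq_zero)
  then obtain A' E0 where A': "A' \<in> sets M" and E0: "E0 \<in> sets M" "0 < emeasure M E0"
    "\<And>x. x \<in> E0 \<Longrightarrow> x \<in> A' \<and> \<tau> (int q) x \<notin> A'"
  proof
    assume "0 < emeasure M (A - T)"
    then show thesis
      using A T sets.sets_into_space[OF A(1)] by (intro that[of A "A - T"]) (auto simp: T_def)
  next
    assume "0 < emeasure M (T - A)"
    then show thesis
      using A T by (intro that[of "space M - A" "T - A"]) (auto simp: T_def)
  qed
  have "\<exists>E\<in>sets M. E \<subseteq> E0 \<and> 0 < emeasure M E \<and> (\<forall>x\<in>E. \<forall>i\<in>{1..k}. \<tau> (int i) x \<notin> E)"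
    if "k \<le> K" for k
    using that
  proof (induction k)
    case 0
    show ?case using E0 by auto
  next
    case (Suc k)
    then obtain E where E: "E \<in> sets M" "E \<subseteq> E0" "0 < emeasure M E"
      "\<And>x i. x \<in> E \<Longrightarrow> i \<in> {1..k} \<Longrightarrow> \<tau> (int i) x \<notin> E"
      by auto
    define s where "s = int (Suc k)"
    have "Suc k dvd q" unfolding q_def using Suc.prems by (intro dvd_fact) auto
    then obtain r where r: "q = Suc k * r" by (rule dvdE)
    define P where "P j = {x \<in> E. \<tau> (s * int j) x \<in> A' \<and> \<tau> (s * int (Suc j)) x \<notin> A'}" for j
    have PE: "P j = E \<inter> (\<tau> (s * int j) -` A' \<inter> space M) - (\<tau> (s * int (Suc j)) -` A' \<inter> space M)" for j
      using sets.sets_into_space[OF E(1)] by (auto simp: P_def)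
    have P: "P j \<in> sets M" for j
      unfolding PE using E(1) measurable_sets[OF meas A'] by auto
    have cover: "E \<subseteq> (\<Union>j<r. P j)"
    proof
      fix x assume x: "x \<in> E"
      then have xM: "x \<in> space M" using sets.sets_into_space[OF E(1)] by auto
      show "x \<in> (\<Union>j<r. P j)"
      proof (rule ccontr)
        assume no: "x \<notin> (\<Union>j<r. P j)"
        have "\<tau> (s * int j) x \<in> A'" if "j \<le> r" for j
          using that
        proof (induction j)
          case 0
          show ?case using E0(3) E(2) x xM by (auto simp: zero)
        next
          case (Suc j)
          then show ?case using no x by (auto simp: P_def)
        qed
        from this[of r] have "\<tau> (int q) x \<in> A'" by (simp add: s_def r algebra_simps)
        then show False using E0(3) E(2) x by auto
      qed
    qed
    have "\<exists>j<r. 0 < emeasure M (P j)"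
    proof (rule ccontr)
      assume "\<not> (\<exists>j<r. 0 < emeasure M (P j))"
      then have "(\<Sum>j<r. emeasure M (P j)) = 0" by (auto simp: zero_less_iff_neq_zero)
      moreover have "emeasure M E \<le> emeasure M (\<Union>j<r. P j)"
        using P by (intro emeasure_mono cover) auto
      moreover have "emeasure M (\<Union>j<r. P j) \<le> (\<Sum>j<r. emeasure M (P j))"
        using P by (intro emeasure_subadditive_finite) auto
      ultimately show False using E(3) by simp
    qed
    then obtain j where j: "0 < emeasure M (P j)" by blast
    have "\<tau> (int i) x \<notin> P j" if x: "x \<in> P j" and i: "i \<in> {1..Suc k}" for x i
    proof (cases "i = Suc k")
      case True
      have "x \<in> space M" using x sets.sets_into_space[OF P] by blast
      then have "\<tau> (s * int j) (\<tau> s x) = \<tau> (s * int (Suc j)) x"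
        using add[of x "s * int j" s] by (simp add: algebra_simps)
      then have "\<tau> s x \<notin> P j" using x unfolding P_def by auto
      then show ?thesis using True by (simp add: s_def)
    next
      case False
      then show ?thesis using E(4)[of x i] x i by (auto simp: P_def)
    qed
    moreover have "P j \<subseteq> E0" using E(2) by (auto simp: P_def)
    ultimately show ?case using P j by blast
  qed
  from this[of K] show ?thesis using that by (metis order_refl atLeastAtMost_iff)
qed

text \<open>
  The set \<open>E\<close> is the base of a tower of height \<open>H\<close>: as it does not return within \<open>H\<close> steps, the
  action is along the orbits of \<open>E\<close> a shift on \<open>{0..<H}\<close>.
\<close>
locale tower = prob_space M for M :: "'a measure" +
  fixes \<tau> :: "int \<Rightarrow> 'a \<Rightarrow> 'a" and E :: "'a set" and H :: nat
  assumes action: "measure_preserving_int_action M \<tau>"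
    and base: "E \<in> sets M" "0 < emeasure M E"
    and no_return: "\<And>x i. x \<in> E \<Longrightarrow> 1 \<le> i \<Longrightarrow> i \<le> H \<Longrightarrow> \<tau> (int i) x \<notin> E"
begin

definition level :: "nat \<Rightarrow> 'a set" where
  "level m = \<tau> (- int m) -` E \<inter> space M"

lemma measurable_action: "\<tau> y \<in> M \<rightarrow>\<^sub>M M"
  using action by (auto simp: measure_preserving_int_action_def)

lemma action_add: "x \<in> space M \<Longrightarrow> \<tau> (y + z) x = \<tau> y (\<tau> z x)"
  using action by (auto simp: measure_preserving_int_action_def)

lemma sets_level [measurable]: "level m \<in> sets M"
  unfolding level_def using measurable_action base(1) by (rule measurable_sets)

lemma measure_base: "0 < prob E"
  using base(2) by (simp add: emeasure_eq_measure)

lemma emeasure_level: "emeasure M (level m) = ennreal (prob E)"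
  using action base(1) by (simp add: level_def measure_preserving_int_action_def emeasure_eq_measure)

lemma levels_disjoint:
  assumes "x \<in> level m" "x \<in> level m'" "m < H" "m' < H"
  shows "m = m'"
proof -
  have less: False if "x \<in> level a" "x \<in> level b" "a < b" "b < H" for a b
  proof -
    have "\<tau> (int (b - a)) (\<tau> (- int b) x) = \<tau> (- int a) x"
      using that by (subst action_add[symmetric]) (auto simp: level_def of_nat_diff)
    moreover have "1 \<le> b - a" "b - a \<le> H" using that by auto
    ultimately show False
      using that(1,2) no_return[of "\<tau> (- int b) x" "b - a"] unfolding level_def by auto
  qed
  show ?thesis using less[of m m'] less[of m' m] assms by (meson linorder_neqE_nat)
qed

lemma mem_level_iff: "x \<in> level m \<Longrightarrow> m < H \<Longrightarrow> k < H \<Longrightarrow> x \<in> level k \<longleftrightarrow> k = m"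
  using levels_disjoint by blast

lemma action_level:
  assumes "x \<in> level m" "i \<le> m"
  shows "\<tau> (- int i) x \<in> level (m - i)"
proof -
  have "x \<in> space M" using assms by (simp add: level_def)
  then have "\<tau> (- int (m - i)) (\<tau> (- int i) x) = \<tau> (- int m) x" "\<tau> (- int i) x \<in> space M"
    using assms(2) action_add[of x "- int (m - i)" "- int i"] measurable_space[OF measurable_action]
    by (simp_all add: of_nat_diff)
  then show ?thesis using assms by (simp add: level_def)
qed

definition tower_function :: "(nat \<Rightarrow> 'b::real_vector) \<Rightarrow> 'a \<Rightarrow> 'b" where
  "tower_function \<phi> x = (\<Sum>m<H. indicat_real (level m) x *\<^sub>R \<phi> m)"

lemma tower_function_level:
  assumes "x \<in> level m" "m < H"
  shows "tower_function \<phi> x = \<phi> m"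
proof -
  have "tower_function \<phi> x = (\<Sum>k<H. if k = m then \<phi> m else 0)"
    unfolding tower_function_def
    by (intro sum.cong refl) (simp add: mem_level_iff[OF assms] indicator_def)
  then show ?thesis using assms(2) by simp
qed

lemma tower_function_outside:
  assumes "\<And>m. m < H \<Longrightarrow> x \<notin> level m"
  shows "tower_function \<phi> x = 0"
  using assms by (simp add: tower_function_def)

lemma square_mean_tower_function:
  assumes "x \<in> level m" "m < H" "N\<^sup>2 \<le> m"
  shows "square_mean \<tau> N (tower_function \<phi>) x = (1 / of_nat N) * (\<Sum>n=1..N. \<phi> (m - n\<^sup>2))"
proof -
  have "tower_function \<phi> (\<tau> (- (int n)\<^sup>2) x) = \<phi> (m - n\<^sup>2)" if n: "n \<in> {1..N}" for n
  proof -
    have "n\<^sup>2 \<le> N\<^sup>2" using n by (intro power_mono) auto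
    then have "n\<^sup>2 \<le> m" using assms(3) by (rule order.trans)
    then have "\<tau> (- int (n\<^sup>2)) x \<in> level (m - n\<^sup>2)" by (rule action_level[OF assms(1)])
    then show ?thesis using assms(2) by (intro tower_function_level) auto
  qed
  then show ?thesis by (simp add: square_mean_def translate_def)
qed

text \<open>
  For \<open>g\<close> the square of the variation, a supremum over uncountably many sequences of times whose
  optimal choice depends on the point, this replaces \<open>g\<close> by a step function on the levels.
\<close>
lemma tower_integral_lower_bound:
  fixes w :: "nat \<Rightarrow> real"
  assumes "G \<subseteq> {..<H}" "\<And>m. m \<in> G \<Longrightarrow> 0 \<le> w m"
    and "\<And>x m. m \<in> G \<Longrightarrow> x \<in> level m \<Longrightarrow> ennreal (w m) \<le> g x"
  shows "ennreal (prob E * (\<Sum>m\<in>G. w m)) \<le> (\<integral>\<^sup>+x. g x \<partial>M)"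
proof -
  have fin: "finite G" using assms(1) finite_subset by blast
  have "ennreal (prob E * (\<Sum>m\<in>G. w m)) = (\<Sum>m\<in>G. ennreal (w m) * ennreal (prob E))"
    using assms(2) by (simp add: sum_distrib_right mult.commute[of "prob E"] sum_ennreal flip: ennreal_mult)
  also have "\<dots> = (\<integral>\<^sup>+x. (\<Sum>m\<in>G. ennreal (w m) * indicator (level m) x) \<partial>M)"
    by (subst nn_integral_sum) (auto simp: nn_integral_cmult_indicator emeasure_level)
  also have "\<dots> \<le> (\<integral>\<^sup>+x. g x \<partial>M)"
  proof (rule nn_integral_mono)
    fix x
    show "(\<Sum>m\<in>G. ennreal (w m) * indicator (level m) x) \<le> g x"
    proof (cases "\<exists>m\<in>G. x \<in> level m")
      case True
      then obtain m where m: "m \<in> G" "x \<in> level m" by blast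
      have "(\<Sum>k\<in>G. ennreal (w k) * indicator (level k) x) = (\<Sum>k\<in>G. if k = m then ennreal (w m) else 0)"
        using m assms(1) by (intro sum.cong refl) (auto simp: indicator_def dest: levels_disjoint[OF m(2)])
      then show ?thesis using m fin assms(3) by simp
    next
      case False
      then show ?thesis by (simp add: indicator_def)
    qed
  qed
  finally show ?thesis .
qed

lemma borel_measurable_tower_function:
  fixes \<phi> :: "nat \<Rightarrow> complex"
  shows "tower_function \<phi> \<in> borel_measurable M"
  unfolding tower_function_def by measurable

lemma nn_integral_tower_function:
  fixes \<phi> :: "nat \<Rightarrow> complex"
  shows "(\<integral>\<^sup>+x. (ennreal (cmod (tower_function \<phi> x)))\<^sup>2 \<partial>M)
       = ennreal (prob E * (\<Sum>m<H. (cmod (\<phi> m))\<^sup>2))"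
proof -
  have "(ennreal (cmod (tower_function \<phi> x)))\<^sup>2
      = (\<Sum>m<H. ennreal ((cmod (\<phi> m))\<^sup>2) * indicator (level m) x)" for x
  proof (cases "\<exists>m<H. x \<in> level m")
    case True
    then obtain m where m: "m < H" "x \<in> level m" by blast
    have "(\<Sum>k<H. ennreal ((cmod (\<phi> k))\<^sup>2) * indicator (level k) x)
        = (\<Sum>k<H. if k = m then ennreal ((cmod (\<phi> m))\<^sup>2) else 0)"
      by (intro sum.cong refl) (simp add: mem_level_iff[OF m(2,1)] indicator_def)
    then show ?thesis using m by (simp add: tower_function_level[OF m(2,1)] ennreal_power)
  next
    case False
    then show ?thesis by (simp add: tower_function_outside indicator_def)
  qed
  then have "(\<integral>\<^sup>+x. (ennreal (cmod (tower_function \<phi> x)))\<^sup>2 \<partial>M)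
      = (\<Sum>m<H. ennreal ((cmod (\<phi> m))\<^sup>2) * ennreal (prob E))"
    by (simp only:) (subst nn_integral_sum, auto simp: nn_integral_cmult_indicator emeasure_level)
  also have "\<dots> = ennreal (prob E * (\<Sum>m<H. (cmod (\<phi> m))\<^sup>2))"
    by (simp add: sum_distrib_right mult.commute[of "prob E"] sum_ennreal flip: ennreal_mult)
  finally show ?thesis .
qed

end

section \<open>Unboundedness of the variation\<close>

theorem theorem1p7:
  fixes M :: "'a measure" and \<tau> :: "int \<Rightarrow> 'a \<Rightarrow> 'a" and C :: real
  assumes "prob_space M"
    and "nonatomic M"
    and "measure_preserving_int_action M \<tau>"
    and "essentially_faithful M \<tau>"
    and "C > 0"
  shows "\<exists>f :: 'a \<Rightarrow> complex. f \<in> borel_measurable M \<and>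
           eL2_norm M (\<lambda>x. ennreal (cmod (f x))) = 1 \<and>
           eL2_norm M (variation2 (\<lambda>N. square_mean \<tau> N f)) \<ge> ennreal C"
proof -
  define energy where "energy B n = (\<Sum>m<scale B (Suc n). (signal B n m)\<^sup>2)" for B n
  have "0 < C\<^sup>2" using assms(5) by simp
  then obtain B n where B: "odd B" and pos: "0 < energy B n"
    and var: "C\<^sup>2 * energy B n \<le> (\<Sum>m\<in>deep B n 0. square_variation (signs B n m))"
    unfolding energy_def by (rule signal_energy_vs_variation)
  have B0: "0 < B" using B by (rule odd_pos)
  define H where "H = scale B (Suc n)"
  obtain E where E: "E \<in> sets M" "0 < emeasure M E"
    "\<And>x i. x \<in> E \<Longrightarrow> 1 \<le> i \<Longrightarrow> i \<le> H \<Longrightarrow> \<tau> (int i) x \<notin> E"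
    using exists_set_without_short_returns[OF assms(3,4), where K = H] by metis
  interpret prob_space M by (rule assms(1))
  interpret tower M \<tau> E H
    using assms(3) E by unfold_locales auto
  \<comment> \<open>The energy of the signal is spread over levels of measure \<open>prob E\<close> each.\<close>
  define c where "c = 1 / sqrt (prob E * energy B n)"
  have pE: "0 < prob E * energy B n" using measure_base pos by simp
  then have c2: "c\<^sup>2 * (prob E * energy B n) = 1"
    by (simp add: c_def power_divide less_le)
  define f where "f = tower_function (\<lambda>m. complex_of_real (c * signal B n m))"
  have deepH: "m < H" if "m \<in> deep B n 0" for m
    unfolding H_def using B0 that by (rule deep_top)
  have mean: "square_mean \<tau> (2 * scale B j) f x = complex_of_real (c * sum_list (drop j (signs B n m)))"
    if "m \<in> deep B n 0" "x \<in> level m" "j \<le> n" for m x j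
  proof -
    let ?N = "2 * scale B j"
    have N: "real ?N \<noteq> 0" using scale_pos[OF B0, of j] by simp
    have "square_mean \<tau> ?N f x
        = (1 / of_nat ?N) * (\<Sum>i=1..?N. complex_of_real (c * signal B n (m - i\<^sup>2)))"
      unfolding f_def
      by (rule square_mean_tower_function[OF that(2) deepH[OF that(1)] square_mean_signal(1)[OF B that(1,3)]])
    also have "\<dots> = complex_of_real (1 / real ?N * (c * (\<Sum>i=1..?N. signal B n (m - i\<^sup>2))))"
      by (simp add: sum_distrib_left)
    also have "1 / real ?N * (c * (\<Sum>i=1..?N. signal B n (m - i\<^sup>2))) = c * sum_list (drop j (signs B n m))"
      unfolding square_mean_signal(2)[OF B that(1,3)] using N by (simp add: field_simps)
    finally show ?thesis .
  qed
  have local_bound: "ennreal (c\<^sup>2 * square_variation (signs B n m)) \<le> (variation2 (\<lambda>N. square_mean \<tau> N f) x)\<^sup>2"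
    if "m \<in> deep B n 0" "x \<in> level m" for m x
  proof (rule square_variation_le_variation2)
    show "square_mean \<tau> (2 * scale B j) f x = complex_of_real (c * sum_list (drop j (signs B n m)))"
      if "j \<le> length (signs B n m)" for j
      using that by (intro mean \<open>m \<in> _\<close> \<open>x \<in> _\<close>) (simp add: signs_def)
    show "strict_mono (\<lambda>j. 2 * scale B j)"
      using strict_mono_scale[OF B0] by (simp add: strict_mono_def)
    show "1 \<le> 2 * scale B j" for j
      using scale_pos[OF B0, of j] by simp
  qed
  have "ennreal (C\<^sup>2) \<le> ennreal (prob E * (\<Sum>m\<in>deep B n 0. c\<^sup>2 * square_variation (signs B n m)))"
  proof (rule ennreal_leI)
    have "C\<^sup>2 = prob E * (c\<^sup>2 * (C\<^sup>2 * energy B n))"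
      using c2 by (simp add: algebra_simps)
    also have "\<dots> \<le> prob E * (c\<^sup>2 * (\<Sum>m\<in>deep B n 0. square_variation (signs B n m)))"
      using var by (intro mult_left_mono) auto
    finally show "C\<^sup>2 \<le> prob E * (\<Sum>m\<in>deep B n 0. c\<^sup>2 * square_variation (signs B n m))"
      by (simp add: sum_distrib_left)
  qed
  also have "\<dots> \<le> (\<integral>\<^sup>+x. (variation2 (\<lambda>N. square_mean \<tau> N f) x)\<^sup>2 \<partial>M)"
    using deepH local_bound square_variation_nonneg by (intro tower_integral_lower_bound) auto
  finally have "esqrt (ennreal (C\<^sup>2)) \<le> eL2_norm M (variation2 (\<lambda>N. square_mean \<tau> N f))"
    unfolding eL2_norm_def by (rule esqrt_mono)
  then have "ennreal C \<le> eL2_norm M (variation2 (\<lambda>N. square_mean \<tau> N f))"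
    using assms(5) by (simp add: esqrt_ennreal)
  moreover have "eL2_norm M (\<lambda>x. ennreal (cmod (f x))) = 1"
  proof -
    have "(\<integral>\<^sup>+x. (ennreal (cmod (f x)))\<^sup>2 \<partial>M) = ennreal (c\<^sup>2 * (prob E * energy B n))"
      unfolding f_def nn_integral_tower_function
      by (simp add: norm_mult power_mult_distrib energy_def H_def sum_distrib_left algebra_simps)
    then show ?thesis unfolding eL2_norm_def c2 by (simp add: esqrt_def)
  qed
  moreover have "f \<in> borel_measurable M"
    unfolding f_def by (rule borel_measurable_tower_function)
  ultimately show ?thesis by blast
qed

end
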